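(* Let $B_0>0$, let $L_{2,0}(r,\theta)$ be the $c=0$ extension of the second Chen–Garay–Zhou family with scale parameter $B_0$ (given explicitly in the context), and set $$\kappa=\frac1{4B_0^2},\qquad x=2\sqrt2\,B_0\,r\cos\theta,\qquad y=2\sqrt2\,B_0\,r\sin\theta,\qquad F_\kappa(x,y)=\begin{pmatrix}\int_0^x e^{i\kappa t^2}\,dt\\ \int_0^y e^{-i\kappa t^2}\,dt\end{pmatrix}\in\mathbb C^2 .$$ Then $$L_{2,0}(r,\theta)=U\,F_\kappa(x,y)\quad\text{for all } r>0,\ 0<\theta<\tfrac{\pi}{2},\qquad U=\frac1{\sqrt2}\begin{pmatrix}1&i\\-i&-1\end{pmatrix},$$ and $U^*U=I_2$, so that $U$ defines a holomorphic isometry of $\mathbb C^2$. Moreover, the same identity holds for all $r>0$ and all $\theta\in\mathbb R$ when $L_{2,0}$ is replaced by its smooth extension $\widehat L_{2,0}$ to $r>0$, $\theta\in\mathbb R$ (given in the context). Consequently the $c=0$ extension is locally congruent to $F_\kappa$, with $B_0=(4\kappa)^{-1/2}$, near every point $(x,y)$ of $\mathbb R^2\setminus\{(0,0)\}$.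
   Context: Let $J_\nu$ denote the Bessel function of the first kind of order $\nu$; for $s>0$, $J_{-1/2}(s)=\sqrt{2/(\pi s)}\cos s$ and $J_{1/2}(s)=\sqrt{2/(\pi s)}\sin s$. For $s\in\mathbb R$, $r>0$ and $\theta\in\mathbb R$ put $$\mathcal I(s)=\int_0^s e^{2it^2}\,dt,\qquad T_0^{\pm}=T_0^\pm(r,\theta)=\int_0^\theta e^{\pm it+ir^2\cos(2t)}\,dt .$$ For $r>0$ and $0<\theta<\pi/2$ define $$\Phi_1=r^2\bigl(iJ_{-1/2}(r^2)T_0^++J_{1/2}(r^2)T_0^-\bigr)+\int_0^r t e^{it^2}\bigl(J_{-1/2}(t^2)+iJ_{1/2}(t^2)\bigr)\,dt,$$ $$\Phi_2=r^2\bigl(iJ_{1/2}(r^2)T_0^+-J_{-1/2}(r^2)T_0^-\bigr)+\int_0^r t e^{it^2}\bigl(J_{1/2}(t^2)-iJ_{-1/2}(t^2)\bigr)\,dt .$$ The $c=0$ extension (obtained by setting the parameter $c=0$ in the formula of Chen, Garay and Zhou for their second family of Lagrangian surfaces in $\mathbb C^2$) is the map $$L_{2,0}(r,\theta)=c_1\Phi_1-c_2\Phi_2\in\mathbb C^2,\qquad c_1=\sqrt{2\pi}\,B_0\,(1,0),\quad c_2=-\sqrt{2\pi}\,B_0\,(0,1).$$ The smooth extension $\widehat L_{2,0}$ is defined for $r>0$, $\theta\in\mathbb R$ by $$\widehat L_{2,0}(r,\theta)=2B_0\begin{pmatrix} r\bigl(i\cos(r^2)T_0^++\sin(r^2)T_0^-\bigr)+\mathcal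 I(r)\\ r\bigl(i\sin(r^2)T_0^+-\cos(r^2)T_0^-\bigr)-i\,\mathcal I(r)\end{pmatrix},$$ which agrees with $L_{2,0}$ for $0<\theta<\pi/2$. Elements of $\mathbb C^2$ are regarded as column vectors, and $U^*$ is the conjugate transpose of $U$. "Locally congruent" means that, locally and after a change of coordinates, the two maps agree up to composition with a holomorphic isometry of $\mathbb C^2$. *)

theory Defs
  imports "HOL-Analysis.Analysis"
begin

(* Bessel function of the first kind of real order, by its power series; only meant for s > 0.
   The entire function rGamma = 1/Gamma makes the terms with a pole of Gamma vanish. *)
definition bessel_J :: "real \<Rightarrow> real \<Rightarrow> real" where
  "bessel_J \<nu> s =
     (\<Sum>m. (-1) ^ m / fact m * rGamma (real m + \<nu> + 1) * (s / 2) powr (2 * real m + \<nu>))"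

(* All integrals below are oriented: for b < a, the interval integral from a to b is
   minus the one from b to a. *)

definition fresnel_I :: "real \<Rightarrow> complex" where
  "fresnel_I s = (LBINT t=0..ereal s. exp (2 * \<i> * complex_of_real (t\<^sup>2)))"

definition T0_plus :: "real \<Rightarrow> real \<Rightarrow> complex" where
  "T0_plus r \<theta> = (LBINT t=0..ereal \<theta>.
     exp (\<i> * complex_of_real t + \<i> * complex_of_real (r\<^sup>2 * cos (2 * t))))"

definition T0_minus :: "real \<Rightarrow> real \<Rightarrow> complex" where
  "T0_minus r \<theta> = (LBINT t=0..ereal \<theta>.
     exp (- \<i> * complex_of_real t + \<i> * complex_of_real (r\<^sup>2 * cos (2 * t))))"

definition Phi1 :: "real \<Rightarrow> real \<Rightarrow> complex" where
  "Phi1 r \<theta> =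
     complex_of_real (r\<^sup>2) *
       (\<i> * complex_of_real (bessel_J (-1/2) (r\<^sup>2)) * T0_plus r \<theta>
        + complex_of_real (bessel_J (1/2) (r\<^sup>2)) * T0_minus r \<theta>)
     + (LBINT t=0..ereal r. complex_of_real t * exp (\<i> * complex_of_real (t\<^sup>2)) *
         (complex_of_real (bessel_J (-1/2) (t\<^sup>2)) + \<i> * complex_of_real (bessel_J (1/2) (t\<^sup>2))))"

definition Phi2 :: "real \<Rightarrow> real \<Rightarrow> complex" where
  "Phi2 r \<theta> =
     complex_of_real (r\<^sup>2) *
       (\<i> * complex_of_real (bessel_J (1/2) (r\<^sup>2)) * T0_plus r \<theta>
        - complex_of_real (bessel_J (-1/2) (r\<^sup>2)) * T0_minus r \<theta>)
     + (LBINT t=0..ereal r. complex_of_real t * exp (\<i> * complex_of_real (t\<^sup>2)) *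
         (complex_of_real (bessel_J (1/2) (t\<^sup>2)) - \<i> * complex_of_real (bessel_J (-1/2) (t\<^sup>2))))"

definition c1_vec :: "real \<Rightarrow> complex ^ 2" where
  "c1_vec B0 = complex_of_real (sqrt (2 * pi) * B0) *s vector [1, 0]"

definition c2_vec :: "real \<Rightarrow> complex ^ 2" where
  "c2_vec B0 = - (complex_of_real (sqrt (2 * pi) * B0) *s vector [0, 1])"

definition L20 :: "real \<Rightarrow> real \<Rightarrow> real \<Rightarrow> complex ^ 2" where
  "L20 B0 r \<theta> = Phi1 r \<theta> *s c1_vec B0 - Phi2 r \<theta> *s c2_vec B0"

definition L20_hat :: "real \<Rightarrow> real \<Rightarrow> real \<Rightarrow> complex ^ 2" where
  "L20_hat B0 r \<theta> = complex_of_real (2 * B0) *s vector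
     [complex_of_real r *
        (\<i> * complex_of_real (cos (r\<^sup>2)) * T0_plus r \<theta>
         + complex_of_real (sin (r\<^sup>2)) * T0_minus r \<theta>) + fresnel_I r,
      complex_of_real r *
        (\<i> * complex_of_real (sin (r\<^sup>2)) * T0_plus r \<theta>
         - complex_of_real (cos (r\<^sup>2)) * T0_minus r \<theta>) - \<i> * fresnel_I r]"

definition F_kappa :: "real \<Rightarrow> real \<Rightarrow> real \<Rightarrow> complex ^ 2" where
  "F_kappa \<kappa> x y = vector
     [LBINT t=0..ereal x. exp (\<i> * complex_of_real (\<kappa> * t\<^sup>2)),
      LBINT t=0..ereal y. exp (- \<i> * complex_of_real (\<kappa> * t\<^sup>2))]"

definition U_mat :: "complex ^ 2 ^ 2" where
  "U_mat = (1 / sqrt 2) *\<^sub>R vector [vector [1, \<i>], vector [-\<i>, -1]]"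

definition conj_transpose :: "complex ^ 'n ^ 'm \<Rightarrow> complex ^ 'm ^ 'n" where
  "conj_transpose A = (\<chi> i j. cnj (A $ j $ i))"

(* Holomorphic on C^n means real differentiable with complex linear derivative, i.e. the derivative
   is multiplication by a complex matrix.  The library norm on complex ^ 'n is the Hermitian one. *)
definition holomorphic_isometry :: "(complex ^ 'n \<Rightarrow> complex ^ 'n) \<Rightarrow> bool" where
  "holomorphic_isometry f \<longleftrightarrow>
     (\<forall>z. \<exists>A :: complex ^ 'n ^ 'n. (f has_derivative (\<lambda>v. A *v v)) (at z)) \<and>
     (\<forall>z w. dist (f z) (f w) = dist z w) \<and>
     surj f"

(* C^k on an open set, by iterated directional derivatives *)
primrec Ck_on :: "nat \<Rightarrow> 'a::real_normed_vector set \<Rightarrow> ('a \<Rightarrow> 'b::real_normed_vector) \<Rightarrow> bool" where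
  "Ck_on 0 S f \<longleftrightarrow> continuous_on S f"
| "Ck_on (Suc k) S f \<longleftrightarrow>
     (\<forall>x\<in>S. f differentiable (at x)) \<and> (\<forall>v. Ck_on k S (\<lambda>x. frechet_derivative f (at x) v))"

definition smooth_on :: "'a::real_normed_vector set \<Rightarrow> ('a \<Rightarrow> 'b::real_normed_vector) \<Rightarrow> bool" where
  "smooth_on S f \<longleftrightarrow> (\<forall>k. Ck_on k S f)"

definition diffeomorphism_between ::
    "'a::real_normed_vector set \<Rightarrow> 'b::real_normed_vector set \<Rightarrow> ('a \<Rightarrow> 'b) \<Rightarrow> bool" where
  "diffeomorphism_between W V \<phi> \<longleftrightarrow>
     (\<exists>\<psi>. homeomorphism W V \<phi> \<psi> \<and> smooth_on W \<phi> \<and> smooth_on V \<psi>)"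

(* The germ of f at p and the germ of g at q agree up to a change of coordinates taking p to q
   and a holomorphic isometry of the target. *)
definition locally_congruent_at ::
    "(real \<times> real) set \<Rightarrow> (real \<times> real \<Rightarrow> complex ^ 'n) \<Rightarrow> real \<times> real \<Rightarrow>
     (real \<times> real) set \<Rightarrow> (real \<times> real \<Rightarrow> complex ^ 'n) \<Rightarrow> real \<times> real \<Rightarrow> bool" where
  "locally_congruent_at S f p T g q \<longleftrightarrow>
     (\<exists>W V \<phi> \<Psi>. open W \<and> p \<in> W \<and> W \<subseteq> S \<and> open V \<and> q \<in> V \<and> V \<subseteq> T \<and>
        diffeomorphism_between W V \<phi> \<and> \<phi> p = q \<and>
        holomorphic_isometry \<Psi> \<and> (\<forall>w\<in>W. f w = \<Psi> (g (\<phi> w))))"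

definition xy_coords :: "real \<Rightarrow> real \<times> real \<Rightarrow> real \<times> real" where
  "xy_coords B0 = (\<lambda>(r, \<theta>). (2 * sqrt 2 * B0 * r * cos \<theta>, 2 * sqrt 2 * B0 * r * sin \<theta>))"

end

(* Both sides of the identity for the smooth extension have the same \<theta>-derivative: with
   r^2 cos 2\<theta> = 2 (r cos \<theta>)^2 - r^2 = r^2 - 2 (r sin \<theta>)^2 the phase of T_0 splits into the phases
   of the two Fresnel integrals times exp(\<plusminus>i r^2), and the coefficients match by Euler's formula.
   At \<theta> = 0 both sides reduce to the Fresnel integral of r.  The unextended map coincides with the
   extension because the Bessel functions of order \<plusminus>1/2 are elementary.  Finally (r, \<theta>) \<mapsto> (x, y)
   is, up to scaling, polar coordinates, a local diffeomorphism with inverse given by the complex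
   logarithm. *)
theory Submission
  imports Defs
begin

section \<open>Oriented integrals from 0 and the Fresnel integral\<close>

lemma has_vector_derivative_interval_integral:
  fixes f :: "real \<Rightarrow> 'a::euclidean_space"
  assumes "continuous_on UNIV f"
  shows "((\<lambda>x. LBINT t=0..ereal x. f t) has_vector_derivative f x) (at x)"
proof -
  have "((\<lambda>u. LBINT t=ereal 0..ereal u. f t) has_vector_derivative f x)
          (at x within {- \<bar>x\<bar> - 1..\<bar>x\<bar> + 1})"
    by (rule interval_integral_FTC2) (auto intro: continuous_on_subset[OF assms])
  moreover have "at x within {- \<bar>x\<bar> - 1..\<bar>x\<bar> + 1} = at x"
    by (rule at_within_interior) auto
  ultimately show ?thesis
    by (simp add: zero_ereal_def)
qed

lemma interval_integral_from_0_eqI: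
  fixes f :: "real \<Rightarrow> 'a::euclidean_space"
  assumes "continuous_on UNIV f" "\<And>t. (F has_vector_derivative f t) (at t)" "F 0 = 0"
  shows "(LBINT t=0..ereal x. f t) = F x"
proof -
  have "(LBINT t=ereal 0..ereal x. f t) = F x - F 0"
    by (rule interval_integral_FTC_finite)
       (auto intro: continuous_on_subset[OF assms(1)] has_vector_derivative_at_within assms(2))
  then show ?thesis
    by (simp add: zero_ereal_def assms(3))
qed

lemma fresnel_I_0 [simp]: "fresnel_I 0 = 0"
  by (simp add: fresnel_I_def zero_ereal_def)

lemma fresnel_I_derivative:
  "(fresnel_I has_vector_derivative exp (2 * \<i> * complex_of_real (x\<^sup>2))) (at x)"
  unfolding fresnel_I_def[abs_def]
  by (rule has_vector_derivative_interval_integral) (intro continuous_intros)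

lemma fresnel_I_chain:
  assumes "(g has_real_derivative g') (at x)"
  shows "((\<lambda>x. fresnel_I (g x)) has_vector_derivative
           complex_of_real g' * exp (2 * \<i> * complex_of_real ((g x)\<^sup>2))) (at x)"
  using vector_diff_chain_at[OF assms[unfolded has_real_derivative_iff_has_vector_derivative]
      fresnel_I_derivative]
  by (simp add: o_def scaleR_conv_of_real)

text \<open>The substitution t = m s turns the phase \<kappa> t^2 into 2 s^2. It is carried out by
  differentiating the rescaled Fresnel integral, which avoids a change of variables. The second
  integrand is the conjugate of the first.\<close>

lemma F_kappa_eq_fresnel_I:
  assumes "m > 0" "\<kappa> * m\<^sup>2 = 2"
  shows "F_kappa \<kappa> (m * x) (m * y) =
           vector [complex_of_real m * fresnel_I x, complex_of_real m * cnj (fresnel_I y)]"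
proof -
  have \<kappa>: "\<kappa> * t\<^sup>2 = 2 * (t / m)\<^sup>2" for t
    using assms by (simp add: field_simps)
  have d: "((\<lambda>t. complex_of_real m * fresnel_I (t / m)) has_vector_derivative
            exp (\<i> * complex_of_real (\<kappa> * t\<^sup>2))) (at t)" for t
  proof -
    have "((\<lambda>t. t / m) has_real_derivative 1 / m) (at t)"
      by (intro DERIV_cdivide DERIV_ident)
    from has_vector_derivative_mult_right[OF fresnel_I_chain[OF this], of "complex_of_real m"]
    moreover have "m \<noteq> 0" using assms(1) by simp
    ultimately show ?thesis unfolding \<kappa> by (simp add: mult.assoc mult.left_commute)
  qed
  have d2: "((\<lambda>t. complex_of_real m * cnj (fresnel_I (t / m))) has_vector_derivative
            exp (- \<i> * complex_of_real (\<kappa> * t\<^sup>2))) (at t)" for t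
    using has_vector_derivative_cnj[OF d] by (simp add: exp_cnj)
  have "(LBINT t=0..ereal (m * x). exp (\<i> * complex_of_real (\<kappa> * t\<^sup>2))) = complex_of_real m * fresnel_I x"
    by (subst interval_integral_from_0_eqI[OF _ d]) (intro continuous_intros, use assms(1) in simp_all)
  moreover have "(LBINT t=0..ereal (m * y). exp (- \<i> * complex_of_real (\<kappa> * t\<^sup>2))) = complex_of_real m * cnj (fresnel_I y)"
    by (subst interval_integral_from_0_eqI[OF _ d2]) (intro continuous_intros, use assms(1) in simp_all)
  ultimately show ?thesis
    by (simp add: F_kappa_def)
qed

section \<open>Angular integrals expressed through Fresnel integrals\<close>

lemma T0_plus_derivative:
  "(T0_plus r has_vector_derivative
      exp (\<i> * complex_of_real t + \<i> * complex_of_real (r\<^sup>2 * cos (2 * t)))) (at t)"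
  unfolding T0_plus_def[abs_def]
  by (rule has_vector_derivative_interval_integral) (intro continuous_intros)

lemma T0_minus_derivative:
  "(T0_minus r has_vector_derivative
      exp (- \<i> * complex_of_real t + \<i> * complex_of_real (r\<^sup>2 * cos (2 * t)))) (at t)"
  unfolding T0_minus_def[abs_def]
  by (rule has_vector_derivative_interval_integral) (intro continuous_intros)

lemma T0_0 [simp]: "T0_plus r 0 = 0" "T0_minus r 0 = 0"
  by (simp_all add: T0_plus_def T0_minus_def zero_ereal_def)

text \<open>This phase and the conjugate one below are brought to the common factor exp(i r^2 cos
  2t), which also occurs in both \<open>T0_plus\<close> and \<open>T0_minus\<close>.\<close>

lemma fresnel_phase_cos: "exp (2 * \<i> * complex_of_real ((r * cos t)\<^sup>2)) =
    exp (\<i> * complex_of_real (r\<^sup>2 * cos (2 * t))) * cis (r\<^sup>2)"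
proof -
  have "2 * (r * cos t)\<^sup>2 = r\<^sup>2 * cos (2 * t) + r\<^sup>2"
    by (simp add: cos_double_cos power_mult_distrib right_diff_distrib)
  then have "2 * complex_of_real ((r * cos t)\<^sup>2) = complex_of_real (r\<^sup>2 * cos (2 * t)) + complex_of_real (r\<^sup>2)"
    by (metis of_real_add of_real_mult of_real_numeral)
  then show ?thesis
    by (simp only: cis_conv_exp mult.assoc mult.left_commute[of 2 \<i>] distrib_left exp_add)
qed

lemma fresnel_phase_sin: "exp (- (2 * \<i> * complex_of_real ((r * sin t)\<^sup>2))) =
    exp (\<i> * complex_of_real (r\<^sup>2 * cos (2 * t))) * cis (- (r\<^sup>2))"
proof -
  have "- (2 * (r * sin t)\<^sup>2) = r\<^sup>2 * cos (2 * t) + - r\<^sup>2"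
    by (simp add: cos_double_sin power_mult_distrib right_diff_distrib)
  then have "- (2 * complex_of_real ((r * sin t)\<^sup>2)) = complex_of_real (r\<^sup>2 * cos (2 * t)) + complex_of_real (- r\<^sup>2)"
    by (metis of_real_add of_real_minus of_real_mult of_real_numeral)
  then show ?thesis
    by (simp only: cis_conv_exp mult.assoc mult.left_commute[of 2 \<i>] distrib_left exp_add flip: mult_minus_right)
qed

lemma constant_of_vector_derivative_0:
  fixes f :: "real \<Rightarrow> 'a::real_normed_vector"
  assumes "\<And>t. (f has_vector_derivative 0) (at t)"
  shows "f x = f y"
  using has_vector_derivative_zero_constant[of UNIV f] assms by (metis UNIV_I convex_UNIV)

text \<open>The hypothesis says that both sides have the same \<theta>-derivative after removal of
  the common factor r exp(i r^2 cos 2t). The parameters a, b, u, v let one argument serve both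
  components of the surface.\<close>

lemma T0_combination_eq_fresnel_I:
  assumes "\<And>t. a * (\<i> * cis t) + b * cis (- t) =
     complex_of_real (- sin t) * (u * cis (r\<^sup>2)) + complex_of_real (cos t) * (v * cis (- (r\<^sup>2)))"
  shows "complex_of_real r * (\<i> * a * T0_plus r \<theta> + b * T0_minus r \<theta>) + u * fresnel_I r
     = u * fresnel_I (r * cos \<theta>) + v * cnj (fresnel_I (r * sin \<theta>))"
proof -
  \<comment> \<open>The term u * \<open>fresnel_I r\<close> is left out because it does not depend
    on \<theta>; it reappears as -D 0.\<close>
  define D where "D \<theta> = complex_of_real r * (\<i> * a * T0_plus r \<theta> + b * T0_minus r \<theta>)
     - (u * fresnel_I (r * cos \<theta>) + v * cnj (fresnel_I (r * sin \<theta>)))" for \<theta>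
  have "(D has_vector_derivative 0) (at t)" for t
  proof -
    let ?e = "exp (\<i> * complex_of_real (r\<^sup>2 * cos (2 * t)))"
    have dc: "((\<lambda>t. r * cos t) has_real_derivative - (r * sin t)) (at t)"
     and ds: "((\<lambda>t. r * sin t) has_real_derivative (r * cos t)) (at t)"
      by (auto intro!: derivative_eq_intros)
    have "(D has_vector_derivative
       complex_of_real r * (\<i> * a * exp (\<i> * complex_of_real t + \<i> * complex_of_real (r\<^sup>2 * cos (2 * t)))
            + b * exp (- \<i> * complex_of_real t + \<i> * complex_of_real (r\<^sup>2 * cos (2 * t))))
        - (u * (complex_of_real (- (r * sin t)) * exp (2 * \<i> * complex_of_real ((r * cos t)\<^sup>2)))
           + v * cnj (complex_of_real (r * cos t) * exp (2 * \<i> * complex_of_real ((r * sin t)\<^sup>2))))) (at t)"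
      unfolding D_def[abs_def]
      by (intro has_vector_derivative_diff has_vector_derivative_add has_vector_derivative_mult_right
          has_vector_derivative_cnj T0_plus_derivative T0_minus_derivative
          fresnel_I_chain[OF dc] fresnel_I_chain[OF ds])
    also have "exp (\<i> * complex_of_real t + \<i> * complex_of_real (r\<^sup>2 * cos (2 * t))) = cis t * ?e"
      by (simp add: exp_add cis_conv_exp)
    also have "exp (- \<i> * complex_of_real t + \<i> * complex_of_real (r\<^sup>2 * cos (2 * t))) = cis (- t) * ?e"
      by (simp only: exp_add cis_conv_exp of_real_minus mult_minus_left mult_minus_right)
    also have "cnj (complex_of_real (r * cos t) * exp (2 * \<i> * complex_of_real ((r * sin t)\<^sup>2))) =
        complex_of_real (r * cos t) * (?e * cis (- (r\<^sup>2)))"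
      using fresnel_phase_sin[of r t] by (simp add: exp_cnj)
    also note fresnel_phase_cos
    also have "complex_of_real r * (\<i> * a * (cis t * ?e) + b * (cis (- t) * ?e)) -
        (u * (complex_of_real (- (r * sin t)) * (?e * cis (r\<^sup>2))) + v * (complex_of_real (r * cos t) * (?e * cis (- r\<^sup>2))))
      = complex_of_real r * ?e * ((a * (\<i> * cis t) + b * cis (- t)) -
        (complex_of_real (- sin t) * (u * cis (r\<^sup>2)) + complex_of_real (cos t) * (v * cis (- (r\<^sup>2)))))"
      by (simp add: algebra_simps)
    also have "\<dots> = 0"
      by (subst assms) simp
    finally show ?thesis .
  qed
  then have "D \<theta> = D 0"
    by (rule constant_of_vector_derivative_0)
  then show ?thesis
    by (simp add: D_def algebra_simps)
qed

section \<open>The identity for the smooth extension, and U as an isometry\<close>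

lemma U_mat_vector:
  "U_mat *v vector [a, b] =
     vector [(a + \<i> * b) / complex_of_real (sqrt 2), (- \<i> * a - b) / complex_of_real (sqrt 2)]"
  by (simp add: vec_eq_iff forall_2 U_mat_def matrix_vector_mult_def sum_2 scaleR_conv_of_real[where 'a = complex]
      add_divide_distrib diff_divide_distrib)

lemma L20_hat_eq:
  assumes "B0 > 0" "\<kappa> = 1 / (4 * B0\<^sup>2)"
  shows "L20_hat B0 r \<theta> =
    U_mat *v F_kappa \<kappa> (2 * sqrt 2 * B0 * r * cos \<theta>) (2 * sqrt 2 * B0 * r * sin \<theta>)"
proof -
  let ?P = "fresnel_I (r * cos \<theta>)" and ?Q = "cnj (fresnel_I (r * sin \<theta>))"
  \<comment> \<open>Here m = 2 sqrt 2 B0, so that \<kappa> m^2 = 8 B0^2 / (4 B0^2) = 2. The factor 1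
    / sqrt 2 in U later reduces m to 2 B0.\<close>
  have "F_kappa \<kappa> (2 * sqrt 2 * B0 * (r * cos \<theta>)) (2 * sqrt 2 * B0 * (r * sin \<theta>)) =
     vector [complex_of_real (2 * sqrt 2 * B0) * ?P, complex_of_real (2 * sqrt 2 * B0) * ?Q]"
    using assms by (intro F_kappa_eq_fresnel_I) (auto simp: power_mult_distrib)
  then have F: "F_kappa \<kappa> (2 * sqrt 2 * B0 * r * cos \<theta>) (2 * sqrt 2 * B0 * r * sin \<theta>) =
     vector [complex_of_real (2 * sqrt 2 * B0) * ?P, complex_of_real (2 * sqrt 2 * B0) * ?Q]"
    by (simp only: mult.assoc)
  \<comment> \<open>First component: u = 1 and v = i, the first row of U up to scaling. The
    coefficient condition is Euler's formula, compared in real and imaginary parts.\<close>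
  have "complex_of_real r * (\<i> * complex_of_real (cos (r\<^sup>2)) * T0_plus r \<theta>
         + complex_of_real (sin (r\<^sup>2)) * T0_minus r \<theta>) + 1 * fresnel_I r = 1 * ?P + \<i> * ?Q"
    by (rule T0_combination_eq_fresnel_I) (simp add: complex_eq_iff algebra_simps)
  \<comment> \<open>Second component: a = sin(r^2), b = -cos(r^2), and (u, v) = (-i, -1) is the
    second row of U up to scaling.\<close>
  moreover have "complex_of_real r * (\<i> * complex_of_real (sin (r\<^sup>2)) * T0_plus r \<theta>
         + (- complex_of_real (cos (r\<^sup>2))) * T0_minus r \<theta>) + (-\<i>) * fresnel_I r = (-\<i>) * ?P + (-1) * ?Q"
    by (rule T0_combination_eq_fresnel_I) (simp add: complex_eq_iff algebra_simps)
  ultimately have L: "L20_hat B0 r \<theta> = complex_of_real (2 * B0) *s vector [?P + \<i> * ?Q, - \<i> * ?P - ?Q]"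
    unfolding L20_hat_def by simp
  show ?thesis
    unfolding L F U_mat_vector
    by (simp add: vec_eq_iff forall_2 field_simps flip: of_real_mult)
qed

text \<open>Since U is Hermitian as well, this involution property yields both unitarity and an
  explicit inverse for surjectivity.\<close>

lemma U_mat_mult_self: "U_mat ** U_mat = mat 1"
  by (simp add: U_mat_def vec_eq_iff forall_2 matrix_matrix_mult_def sum_2 mat_def flip: scaleR_add_left)

lemma conj_transpose_U_mat: "conj_transpose U_mat = U_mat"
  by (simp add: U_mat_def vec_eq_iff forall_2 conj_transpose_def)

text \<open>Because -i a - b = -i (a - i b), this is the parallelogram law |a + i b|^2 + |a - i b|^2
  = 2 |a|^2 + 2 |b|^2.\<close>

lemma norm_U_mat: "norm (U_mat *v z) = norm z"
proof -
  have n: "(norm w)\<^sup>2 = (norm (w$1))\<^sup>2 + (norm (w$2))\<^sup>2" for w :: "complex ^ 2"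
    by (simp add: norm_vec_def L2_set_def sum_2)
  have "z = vector [z$1, z$2]"
    by (simp add: vec_eq_iff forall_2)
  then have "U_mat *v z = vector [(z$1 + \<i> * z$2) / complex_of_real (sqrt 2),
      (- \<i> * z$1 - z$2) / complex_of_real (sqrt 2)]"
    using U_mat_vector by metis
  then have "(norm (U_mat *v z))\<^sup>2 = (norm (z$1 + \<i> * z$2))\<^sup>2 / 2 + (norm (- \<i> * z$1 - z$2))\<^sup>2 / 2"
    by (simp add: n norm_divide power_divide)
  also have "\<dots> = (norm z)\<^sup>2"
    unfolding n cmod_power2 by (simp add: power2_eq_square field_simps)
  finally show ?thesis
    by simp
qed

lemma holomorphic_isometry_U_mat: "holomorphic_isometry (\<lambda>z. U_mat *v z)"
  unfolding holomorphic_isometry_def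
proof (intro conjI allI)
  show "\<exists>A. ((*v) U_mat has_derivative (*v) A) (at z)" for z
    by (intro exI[of _ U_mat] bounded_linear_imp_has_derivative matrix_vector_mul_bounded_linear)
  show "dist (U_mat *v z) (U_mat *v w) = dist z w" for z w
    by (simp add: dist_norm norm_U_mat flip: matrix_vector_mult_diff_distrib)
  show "surj ((*v) U_mat)"
    by (rule surjI[of _ "(*v) U_mat"]) (simp add: matrix_vector_mul_assoc U_mat_mult_self)
qed

section \<open>Bessel functions of order -1/2 and 1/2\<close>

text \<open>One use of the recursion of Gamma at m + 1/2. It is conditional so that it can serve
  inside the induction for \<open>rGamma_half_fact\<close> and afterwards be freed of its
  hypothesis.\<close>

lemma rGamma_three_halves_step:
  assumes "rGamma (real m + 1/2) / fact m = 4 ^ m / (fact (2 * m) * sqrt pi)"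
  shows "rGamma (real m + 3/2) / fact m = 2 * 4 ^ m / (fact (2 * m + 1) * sqrt pi)"
proof -
  have "rGamma (real m + 1/2) = (real m + 1/2) * rGamma (real m + 1/2 + 1)"
    by (rule rGamma_plus1[symmetric])
  moreover have "real m + 1/2 + 1 = real m + 3/2"
    by simp
  ultimately have "(rGamma (real m + 3/2) / fact m) * (real m + 1/2) = 4 ^ m / (fact (2 * m) * sqrt pi)"
    using assms by (metis times_divide_eq_left mult.commute)
  then have "rGamma (real m + 3/2) / fact m = 4 ^ m / (fact (2 * m) * sqrt pi) / (real m + 1/2)"
    by (subst nonzero_eq_divide_eq) auto
  also have "\<dots> = 2 * 4 ^ m / ((real m * 2 + 1) * fact (2 * m) * sqrt pi)"
    by (simp add: divide_simps)
  finally show ?thesis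
    by (simp add: algebra_simps)
qed

text \<open>Legendre's duplication formula at m + 1/2, started from Gamma(1/2) = sqrt pi.\<close>

lemma rGamma_half_fact:
  "rGamma (real m + 1/2) / fact m = 4 ^ m / (fact (2 * m) * sqrt pi)"
proof (induction m)
  case 0
  then show ?case
    by (simp add: rGamma_inverse_Gamma Gamma_one_half_real field_simps)
next
  case (Suc m)
  have "real (Suc m) + 1/2 = real m + 3/2"
    by simp
  then have "rGamma (real (Suc m) + 1/2) / fact (Suc m) = rGamma (real m + 3/2) / fact m / (real m + 1)"
    by (simp add: mult.commute add.commute)
  also have "\<dots> = 2 * 4 ^ m / (fact (2 * m + 1) * sqrt pi) / (real m + 1)"
    by (simp only: rGamma_three_halves_step[OF Suc])
  also have "\<dots> = 4 ^ Suc m / ((2 * real m + 2) * fact (2 * m + 1) * sqrt pi)"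
    by (simp add: divide_simps)
  also have "(2 * real m + 2) * fact (2 * m + 1) = fact (2 * Suc m)"
    by simp
  finally show ?case .
qed

lemmas rGamma_three_halves_fact = rGamma_three_halves_step[OF rGamma_half_fact]

text \<open>Separates the even integer power, whose 4 ^ m cancels the one from the Gamma values,
  from the fixed fractional power.\<close>

lemma half_powr:
  assumes "s > (0::real)"
  shows "(s / 2) powr (2 * real m + \<nu>) = s ^ (2 * m) / 4 ^ m * (s / 2) powr \<nu>"
proof -
  have "(s / 2) powr (2 * real m) = (s / 2) ^ (2 * m)"
    using assms by (subst powr_realpow[symmetric]) auto
  then show ?thesis by (simp add: powr_add power_divide power_mult)
qed

text \<open>After the cancellation of 4 ^ m the series is, term by term, a multiple of the cosine
  series.\<close>

lemma bessel_J_minus_half: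
  assumes "s > 0"
  shows "bessel_J (-1/2) s = sqrt (2 / (pi * s)) * cos s"
proof -
  have p: "(s / 2) powr (-1/2) = sqrt (2 / s)"
    using assms powr_minus[of "s / 2" "1/2"] by (simp add: powr_half_sqrt real_sqrt_divide)
  have t: "(-1) ^ m / fact m * rGamma (real m + -1/2 + 1) * (s / 2) powr (2 * real m + -1/2)
      = sqrt (2 / (pi * s)) * ((-1) ^ m / fact (2 * m) * s ^ (2 * m))" for m
  proof -
    have "real m + -1/2 + 1 = real m + 1/2" by simp
    then have "(-1) ^ m / fact m * rGamma (real m + -1/2 + 1) * (s / 2) powr (2 * real m + -1/2)
      = (-1) ^ m * (rGamma (real m + 1/2) / fact m) * (s ^ (2 * m) / 4 ^ m * sqrt (2 / s))"
      by (simp only: half_powr[OF assms] p) simp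
    also have "\<dots> = sqrt (2 / (pi * s)) * ((-1) ^ m / fact (2 * m) * s ^ (2 * m))"
      unfolding rGamma_half_fact by (simp add: real_sqrt_divide real_sqrt_mult mult_ac)
    finally show ?thesis .
  qed
  have "(\<lambda>m. sqrt (2 / (pi * s)) * ((-1) ^ m / fact (2 * m) * s ^ (2 * m))) sums (sqrt (2 / (pi * s)) * cos s)"
    by (rule sums_mult[OF cos_paired])
  then show ?thesis unfolding bessel_J_def t by (rule sums_unique[symmetric])
qed

lemma bessel_J_half:
  assumes "s > 0"
  shows "bessel_J (1/2) s = sqrt (2 / (pi * s)) * sin s"
proof -
  \<comment> \<open>In this form the factor s supplies the odd powers of the sine series, and the
    1/2 cancels the 2 in \<open>rGamma_three_halves_fact\<close>.\<close>
  have p: "(s / 2) powr (1/2) = s / 2 * sqrt (2 / s)"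
  proof -
    have "sqrt (s/2) = sqrt ((s/2)^2 * (2/s))" using assms by (simp add: power2_eq_square)
    also have "\<dots> = s / 2 * sqrt (2 / s)" using assms by (subst real_sqrt_mult) simp
    finally show ?thesis using assms by (simp add: powr_half_sqrt)
  qed
  have t: "(-1) ^ m / fact m * rGamma (real m + 1/2 + 1) * (s / 2) powr (2 * real m + 1/2)
      = sqrt (2 / (pi * s)) * ((-1) ^ m / fact (2 * m + 1) * s ^ (2 * m + 1))" for m
  proof -
    have "real m + 1/2 + 1 = real m + 3/2" by simp
    then have "(-1) ^ m / fact m * rGamma (real m + 1/2 + 1) * (s / 2) powr (2 * real m + 1/2)
      = (-1) ^ m * (rGamma (real m + 3/2) / fact m) * (s ^ (2 * m) / 4 ^ m * (s / 2 * sqrt (2 / s)))"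
      by (simp only: half_powr[OF assms] p) simp
    also have "\<dots> = sqrt (2 / (pi * s)) * ((-1) ^ m / fact (2 * m + 1) * s ^ (2 * m + 1))"
      unfolding rGamma_three_halves_fact by (simp add: real_sqrt_divide real_sqrt_mult mult_ac)
    finally show ?thesis .
  qed
  have "(\<lambda>m. sqrt (2 / (pi * s)) * ((-1) ^ m / fact (2 * m + 1) * s ^ (2 * m + 1))) sums (sqrt (2 / (pi * s)) * sin s)"
    by (rule sums_mult[OF sin_paired])
  then show ?thesis unfolding bessel_J_def t by (rule sums_unique[symmetric])
qed

section \<open>Agreement of the Bessel form with the smooth extension\<close>

lemma L20_eq_L20_hat:
  assumes "r > 0"
  shows "L20 B0 r \<theta> = L20_hat B0 r \<theta>"
proof -
  let ?c = "complex_of_real (sqrt (2 / pi))"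
  \<comment> \<open>At argument t^2 the Bessel amplitude is sqrt (2 / pi) / t. It absorbs the weight
    t of the integrals, and one factor of r^2 in front of the angular terms.\<close>
  have J: "t * bessel_J (-1/2) (t\<^sup>2) = sqrt (2 / pi) * cos (t\<^sup>2)"
          "t * bessel_J (1/2) (t\<^sup>2) = sqrt (2 / pi) * sin (t\<^sup>2)" if "t > 0" for t
    using that bessel_J_minus_half[of "t\<^sup>2"] bessel_J_half[of "t\<^sup>2"]
    by (simp_all add: real_sqrt_divide real_sqrt_mult)
  have Jc: "complex_of_real t * complex_of_real (bessel_J (-1/2) (t\<^sup>2)) = ?c * complex_of_real (cos (t\<^sup>2))"
          "complex_of_real t * complex_of_real (bessel_J (1/2) (t\<^sup>2)) = ?c * complex_of_real (sin (t\<^sup>2))" if "t > 0" for t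
    using J[OF that] by (simp_all only: flip: of_real_mult)
  have e: "exp (\<i> * complex_of_real s) * (complex_of_real (cos s) + \<i> * complex_of_real (sin s)) = exp (2 * \<i> * complex_of_real s)" for s
    by (simp add: exp_double mult.assoc power2_eq_square exp_Euler cos_of_real sin_of_real)
  have "complex_of_real t * exp (\<i> * complex_of_real (t\<^sup>2)) *
         (complex_of_real (bessel_J (-1/2) (t\<^sup>2)) + \<i> * complex_of_real (bessel_J (1/2) (t\<^sup>2)))
         = ?c * exp (2 * \<i> * complex_of_real (t\<^sup>2))" if "t > 0" for t
  proof -
    have "complex_of_real t * exp (\<i> * complex_of_real (t\<^sup>2)) *
         (complex_of_real (bessel_J (-1/2) (t\<^sup>2)) + \<i> * complex_of_real (bessel_J (1/2) (t\<^sup>2)))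
       = exp (\<i> * complex_of_real (t\<^sup>2)) * (complex_of_real t * complex_of_real (bessel_J (-1/2) (t\<^sup>2))
           + \<i> * (complex_of_real t * complex_of_real (bessel_J (1/2) (t\<^sup>2))))"
      by (simp add: algebra_simps)
    then show ?thesis unfolding Jc[OF that] e[symmetric] by (simp add: algebra_simps)
  qed
  then have "(LBINT t=0..ereal r. complex_of_real t * exp (\<i> * complex_of_real (t\<^sup>2)) *
         (complex_of_real (bessel_J (-1/2) (t\<^sup>2)) + \<i> * complex_of_real (bessel_J (1/2) (t\<^sup>2))))
      = (LBINT t=0..ereal r. ?c * exp (2 * \<i> * complex_of_real (t\<^sup>2)))"
    \<comment> \<open>The integrands are compared only on the open interval (0, r), so the Bessel
      functions are never evaluated at 0.\<close>
    using assms by (intro interval_integral_cong) (auto simp: zero_ereal_def einterval_def)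
  then have i1: "(LBINT t=0..ereal r. complex_of_real t * exp (\<i> * complex_of_real (t\<^sup>2)) *
         (complex_of_real (bessel_J (-1/2) (t\<^sup>2)) + \<i> * complex_of_real (bessel_J (1/2) (t\<^sup>2))))
      = ?c * fresnel_I r"
    by (simp add: fresnel_I_def)
  \<comment> \<open>The second integrand is -i times the first, so no separate evaluation is
    required.\<close>
  have "complex_of_real t * exp (\<i> * complex_of_real (t\<^sup>2)) *
         (complex_of_real (bessel_J (1/2) (t\<^sup>2)) - \<i> * complex_of_real (bessel_J (-1/2) (t\<^sup>2)))
         = - \<i> * (complex_of_real t * exp (\<i> * complex_of_real (t\<^sup>2)) *
         (complex_of_real (bessel_J (-1/2) (t\<^sup>2)) + \<i> * complex_of_real (bessel_J (1/2) (t\<^sup>2))))" for t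
    by (simp add: algebra_simps)
  then have i2: "(LBINT t=0..ereal r. complex_of_real t * exp (\<i> * complex_of_real (t\<^sup>2)) *
         (complex_of_real (bessel_J (1/2) (t\<^sup>2)) - \<i> * complex_of_real (bessel_J (-1/2) (t\<^sup>2))))
      = - \<i> * (?c * fresnel_I r)"
    by (simp only: interval_lebesgue_integral_mult_right i1)
  have P1: "Phi1 r \<theta> = ?c * (complex_of_real r *
        (\<i> * complex_of_real (cos (r\<^sup>2)) * T0_plus r \<theta>
         + complex_of_real (sin (r\<^sup>2)) * T0_minus r \<theta>) + fresnel_I r)"
  proof -
    have "Phi1 r \<theta> = complex_of_real r * (\<i> * (complex_of_real r * complex_of_real (bessel_J (-1/2) (r\<^sup>2))) * T0_plus r \<theta>
        + (complex_of_real r * complex_of_real (bessel_J (1/2) (r\<^sup>2))) * T0_minus r \<theta>) + ?c * fresnel_I r"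
      unfolding Phi1_def i1 by (simp add: power2_eq_square algebra_simps)
    then show ?thesis unfolding Jc[OF assms] by (simp add: algebra_simps)
  qed
  have P2: "Phi2 r \<theta> = ?c * (complex_of_real r *
        (\<i> * complex_of_real (sin (r\<^sup>2)) * T0_plus r \<theta>
         - complex_of_real (cos (r\<^sup>2)) * T0_minus r \<theta>) - \<i> * fresnel_I r)"
  proof -
    have "Phi2 r \<theta> = complex_of_real r * (\<i> * (complex_of_real r * complex_of_real (bessel_J (1/2) (r\<^sup>2))) * T0_plus r \<theta>
        - (complex_of_real r * complex_of_real (bessel_J (-1/2) (r\<^sup>2))) * T0_minus r \<theta>) - \<i> * (?c * fresnel_I r)"
      unfolding Phi2_def i2 by (simp add: power2_eq_square algebra_simps)
    then show ?thesis unfolding Jc[OF assms] by (simp add: algebra_simps)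
  qed
  \<comment> \<open>The Bessel normalisation times the constant in \<open>c1_vec\<close> and
    \<open>c2_vec\<close> gives the factor 2 B0 of the extension.\<close>
  have "sqrt (2 / pi) * sqrt (2 * pi) = 2"
    by (simp flip: real_sqrt_mult)
  then have k: "?c * complex_of_real (sqrt (2 * pi) * B0) = complex_of_real (2 * B0)"
    by (metis mult.assoc of_real_mult)
  have k': "(?c * X) * complex_of_real (sqrt (2 * pi) * B0) = complex_of_real (2 * B0) * X" for X
    unfolding k[symmetric] by (simp add: mult_ac)
  show ?thesis
    by (simp only: L20_def L20_hat_def P1 P2 c1_vec_def c2_vec_def vec_eq_iff forall_2
        vector_minus_component vector_uminus_component vector_smult_component vector_2)
       (simp only: mult_1_right mult_zero_right minus_zero diff_0_right diff_0 mult_minus_right minus_minus k')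
qed

section \<open>Smoothness from algebras closed under differentiation\<close>

text \<open>Derivatives at points of an open set are local, so equality on S passes to all
  directional derivatives. This allows \<open>frechet_derivative\<close> to be replaced by a formula
  valid only on S.\<close>

lemma Ck_on_cong:
  assumes "open S" "\<And>x. x \<in> S \<Longrightarrow> f x = g x" "Ck_on k S f"
  shows "Ck_on k S g"
  using assms(2,3)
proof (induction k arbitrary: f g)
  case 0
  then show ?case by (simp cong: continuous_on_cong)
next
  case (Suc k)
  have iff: "(f has_derivative D) (at x) \<longleftrightarrow> (g has_derivative D) (at x)" if "x \<in> S" for x D
    using has_derivative_transform_within_open[OF _ assms(1) that, of f D UNIV g]
      has_derivative_transform_within_open[OF _ assms(1) that, of g D UNIV f] Suc.prems(1) by metis
  have "frechet_derivative f (at x) v = frechet_derivative g (at x) v" if "x \<in> S" for x v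
    by (simp add: frechet_derivative_def iff[OF that])
  moreover have "\<forall>x\<in>S. g differentiable (at x)"
    using Suc.prems(2) iff by (auto simp: differentiable_def)
  ultimately show ?case
    using Suc.IH[of "\<lambda>x. frechet_derivative f (at x) v" "\<lambda>x. frechet_derivative g (at x) v" for v]
      Suc.prems(2) by simp
qed

text \<open>To show smoothness in the sense of \<^const>\<open>smooth_on\<close> it suffices to embed a function in an
  algebra whose generators have all their directional derivatives in that algebra.\<close>

inductive_set generated_algebra :: "('a \<Rightarrow> real) set \<Rightarrow> ('a \<Rightarrow> real) set" for B where
  const: "(\<lambda>_. c) \<in> generated_algebra B"
| gen: "f \<in> B \<Longrightarrow> f \<in> generated_algebra B"
| add: "f \<in> generated_algebra B \<Longrightarrow> g \<in> generated_algebra B \<Longrightarrow> (\<lambda>x. f x + g x) \<in> generated_algebra B"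
| mult: "f \<in> generated_algebra B \<Longrightarrow> g \<in> generated_algebra B \<Longrightarrow> (\<lambda>x. f x * g x) \<in> generated_algebra B"

text \<open>Agreement with a member of A is asked only on S, since functions such as a branch of the
  angle are differentiable only there. The member may depend on the direction.\<close>

definition derivatives_in ::
    "('a::real_normed_vector \<Rightarrow> real) set \<Rightarrow> 'a set \<Rightarrow> ('a \<Rightarrow> real) \<Rightarrow> bool" where
  "derivatives_in A S f \<longleftrightarrow>
     (\<exists>f'. (\<forall>x\<in>S. (f has_derivative f' x) (at x)) \<and> (\<forall>v. \<exists>h\<in>A. \<forall>x\<in>S. f' x v = h x))"

lemma derivatives_inI:
  assumes "\<And>x. x \<in> S \<Longrightarrow> (f has_derivative (\<lambda>v. h v x)) (at x)" "\<And>v. h v \<in> A"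
  shows "derivatives_in A S f"
  unfolding derivatives_in_def using assms by (intro exI[of _ "\<lambda>x v. h v x"]) blast

text \<open>By the sum and product rules, closure under directional derivatives needs checking on
  generators only.\<close>

lemma derivatives_in_generated_algebra:
  assumes gens: "\<And>g. g \<in> B \<Longrightarrow> derivatives_in (generated_algebra B) S g"
    and "f \<in> generated_algebra B"
  shows "derivatives_in (generated_algebra B) S f"
  using assms(2)
proof induction
  case (const c)
  show ?case
    by (rule derivatives_inI[where h = "\<lambda>_ _. 0"]) (auto intro: generated_algebra.const)
next
  case (gen f)
  then show ?case by (rule gens)
next
  case (add f g)
  from add.IH obtain f' g'
    where f': "\<And>x. x \<in> S \<Longrightarrow> (f has_derivative f' x) (at x)"
      "\<And>v. \<exists>h\<in>generated_algebra B. \<forall>x\<in>S. f' x v = h x"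
    and g': "\<And>x. x \<in> S \<Longrightarrow> (g has_derivative g' x) (at x)"
      "\<And>v. \<exists>h\<in>generated_algebra B. \<forall>x\<in>S. g' x v = h x"
    unfolding derivatives_in_def by blast
  have "\<exists>h\<in>generated_algebra B. \<forall>x\<in>S. f' x v + g' x v = h x" for v
    using f'(2)[of v] g'(2)[of v] generated_algebra.add by force
  moreover have "\<forall>x\<in>S. ((\<lambda>x. f x + g x) has_derivative (\<lambda>v. f' x v + g' x v)) (at x)"
    using f'(1) g'(1) by (auto intro: has_derivative_add)
  ultimately show ?case
    unfolding derivatives_in_def by (intro exI[of _ "\<lambda>x v. f' x v + g' x v"]) blast
next
  case (mult f g)
  from mult.IH obtain f' g'
    where f': "\<And>x. x \<in> S \<Longrightarrow> (f has_derivative f' x) (at x)"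
      "\<And>v. \<exists>h\<in>generated_algebra B. \<forall>x\<in>S. f' x v = h x"
    and g': "\<And>x. x \<in> S \<Longrightarrow> (g has_derivative g' x) (at x)"
      "\<And>v. \<exists>h\<in>generated_algebra B. \<forall>x\<in>S. g' x v = h x"
    unfolding derivatives_in_def by blast
  have "\<exists>h\<in>generated_algebra B. \<forall>x\<in>S. f x * g' x v + f' x v * g x = h x" for v
  proof -
    obtain h k where "h \<in> generated_algebra B" "k \<in> generated_algebra B"
      and "\<forall>x\<in>S. f' x v = h x" "\<forall>x\<in>S. g' x v = k x"
      using f'(2) g'(2) by meson
    then show ?thesis
      using mult.hyps
      by (intro bexI[of _ "\<lambda>x. f x * k x + h x * g x"] generated_algebra.add generated_algebra.mult) auto
  qed
  moreover have "\<forall>x\<in>S. ((\<lambda>x. f x * g x) has_derivative (\<lambda>v. f x * g' x v + f' x v * g x)) (at x)"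
    using f'(1) g'(1) by (auto intro: has_derivative_mult)
  ultimately show ?case
    unfolding derivatives_in_def by (intro exI[of _ "\<lambda>x v. f x * g' x v + f' x v * g x"]) blast
qed

text \<open>A directional derivative of a pair from the algebra is, on S, again such a pair. Hence
  the induction on k runs over all pairs at once.\<close>

lemma smooth_on_pair_generated_algebra:
  assumes "open S" "\<And>g. g \<in> B \<Longrightarrow> derivatives_in (generated_algebra B) S g"
    and "f \<in> generated_algebra B" "g \<in> generated_algebra B"
  shows "smooth_on S (\<lambda>x. (f x, g x))"
  unfolding smooth_on_def
proof
  fix k
  show "Ck_on k S (\<lambda>x. (f x, g x))"
    using assms(3,4)
  proof (induction k arbitrary: f g)
    case (0 f g)
    have "continuous_on S h" if "h \<in> generated_algebra B" for h
      using derivatives_in_generated_algebra[OF assms(2) that]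
      by (metis continuous_at_imp_continuous_on derivatives_in_def has_derivative_continuous)
    then show ?case
      using 0 by (simp add: continuous_on_Pair)
  next
    case (Suc k f g)
    obtain f' g'
      where f': "\<And>x. x \<in> S \<Longrightarrow> (f has_derivative f' x) (at x)"
        "\<And>v. \<exists>h\<in>generated_algebra B. \<forall>x\<in>S. f' x v = h x"
      and g': "\<And>x. x \<in> S \<Longrightarrow> (g has_derivative g' x) (at x)"
        "\<And>v. \<exists>h\<in>generated_algebra B. \<forall>x\<in>S. g' x v = h x"
      using derivatives_in_generated_algebra[OF assms(2) Suc.prems(1)]
        derivatives_in_generated_algebra[OF assms(2) Suc.prems(2)]
      unfolding derivatives_in_def by blast
    have d: "((\<lambda>x. (f x, g x)) has_derivative (\<lambda>v. (f' x v, g' x v))) (at x)" if "x \<in> S" for x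
      using f'(1)[OF that] g'(1)[OF that] by (rule has_derivative_Pair)
    have "Ck_on k S (\<lambda>x. frechet_derivative (\<lambda>x. (f x, g x)) (at x) v)" for v
    proof -
      obtain h h' where h: "h \<in> generated_algebra B" "h' \<in> generated_algebra B"
        and eq: "\<forall>x\<in>S. f' x v = h x" "\<forall>x\<in>S. g' x v = h' x"
        using f'(2) g'(2) by meson
      show ?thesis
      proof (rule Ck_on_cong[OF assms(1) _ Suc.IH[OF h]])
        show "(h x, h' x) = frechet_derivative (\<lambda>x. (f x, g x)) (at x) v" if "x \<in> S" for x
          using frechet_derivative_at[OF d[OF that], symmetric] eq that by simp
      qed
    qed
    then show ?case
      using d by (auto simp: differentiable_def)
  qed
qed

section \<open>Polar coordinates as a local diffeomorphism\<close>

text \<open>The algebra generated by r, cos \<theta> and sin \<theta> is closed under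
  differentiation.\<close>

lemma smooth_on_polar_map:
  fixes S :: "(real \<times> real) set"
  assumes "open S"
  shows "smooth_on S (\<lambda>p. (c * fst p * cos (snd p), c * fst p * sin (snd p)))"
proof -
  define B :: "(real \<times> real \<Rightarrow> real) set"
    where "B = {fst, \<lambda>p. cos (snd p), \<lambda>p. sin (snd p)}"
  have gens: "fst \<in> generated_algebra B" "(\<lambda>p. cos (snd p)) \<in> generated_algebra B"
    "(\<lambda>p. sin (snd p)) \<in> generated_algebra B"
    by (auto simp: B_def intro: generated_algebra.gen)
  have "derivatives_in (generated_algebra B) S fst"
    by (rule derivatives_inI[where h = "\<lambda>v p. fst v"])
       (auto intro!: derivative_eq_intros generated_algebra.intros)
  moreover have "derivatives_in (generated_algebra B) S (\<lambda>p. cos (snd p))"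
  proof (rule derivatives_inI)
    show "((\<lambda>p. cos (snd p)) has_derivative (\<lambda>v. - snd v * sin (snd p))) (at p)" for p :: "real \<times> real"
      by (auto intro!: derivative_eq_intros)
    show "(\<lambda>p. - snd v * sin (snd p)) \<in> generated_algebra B" for v :: "real \<times> real"
      by (intro generated_algebra.mult generated_algebra.const gens)
  qed
  moreover have "derivatives_in (generated_algebra B) S (\<lambda>p. sin (snd p))"
    by (rule derivatives_inI[where h = "\<lambda>v p. snd v * cos (snd p)"])
       (auto intro!: derivative_eq_intros generated_algebra.mult generated_algebra.const gens)
  ultimately show ?thesis
    by (intro smooth_on_pair_generated_algebra[OF assms, of B] generated_algebra.mult generated_algebra.const gens)
       (auto simp: B_def)
qed

text \<open>On \<open>slit_plane\<close> this is the branch of the argument with values within pi of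
  \<open>\<theta>0\<close>: rotate the direction \<open>\<theta>0\<close> to the positive real axis,
  take the principal argument, rotate back.\<close>

definition polar_angle :: "real \<Rightarrow> real \<times> real \<Rightarrow> real" where
  "polar_angle \<theta>0 p = \<theta>0 + Im (Ln (Complex (fst p) (snd p) * cis (- \<theta>0)))"

text \<open>The plane without the closed ray from the origin opposite to the direction
  \<open>\<theta>0\<close>.\<close>

definition slit_plane :: "real \<Rightarrow> (real \<times> real) set" where
  "slit_plane \<theta>0 = {p. Complex (fst p) (snd p) * cis (- \<theta>0) \<notin> \<real>\<^sub>\<le>\<^sub>0}"

lemma open_slit_plane: "open (slit_plane \<theta>0)"
proof -
  have "continuous_on UNIV (\<lambda>p :: real \<times> real. Complex (fst p) (snd p) * cis (- \<theta>0))"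
    unfolding Complex_eq by (intro continuous_intros)
  then have "open ((\<lambda>p. Complex (fst p) (snd p) * cis (- \<theta>0)) -` (- \<real>\<^sub>\<le>\<^sub>0))"
    by (intro open_vimage) auto
  then show ?thesis
    by (simp add: slit_plane_def vimage_def)
qed

lemma slit_plane_nonzero: "p \<in> slit_plane \<theta>0 \<Longrightarrow> 0 < (fst p)\<^sup>2 + (snd p)\<^sup>2"
  by (cases "p = (0, 0)")
     (auto simp: slit_plane_def sum_power2_gt_zero_iff prod_eq_iff Complex_eq)

text \<open>The classical form (x dy - y dx) / (x^2 + y^2). The denominator is written through the
  inverse norm, which is a generator in the smoothness proof.\<close>

lemma polar_angle_has_derivative:
  assumes "p \<in> slit_plane \<theta>0"
  shows "(polar_angle \<theta>0 has_derivative
           (\<lambda>v. (fst p * snd v - snd p * fst v) * (inverse (sqrt ((fst p)\<^sup>2 + (snd p)\<^sup>2)))\<^sup>2)) (at p)"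
proof -
  let ?w = "\<lambda>p. Complex (fst p) (snd p) * cis (- \<theta>0)"
  have w: "(?w has_derivative ?w) (at p)"
    unfolding Complex_eq by (auto intro!: derivative_eq_intros)
  have "(Ln has_derivative (*) (inverse (?w p))) (at (?w p))"
    using has_field_derivative_Ln[of "?w p"] assms
    by (simp add: slit_plane_def has_field_derivative_def)
  from has_derivative_compose[OF w this]
  have "(polar_angle \<theta>0 has_derivative (\<lambda>v. 0 + Im (inverse (?w p) * ?w v))) (at p)"
    unfolding polar_angle_def[abs_def]
    by (intro has_derivative_add has_derivative_const has_derivative_Im)
  moreover have "0 + Im (inverse (?w p) * ?w v) =
      (fst p * snd v - snd p * fst v) * (inverse (sqrt ((fst p)\<^sup>2 + (snd p)\<^sup>2)))\<^sup>2" for v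
  proof -
    \<comment> \<open>The rotation by \<open>\<theta>0\<close> cancels in the logarithmic
      derivative.\<close>
    have *: "inverse (?w p) * ?w v = Complex (fst v) (snd v) / Complex (fst p) (snd p)"
      by (simp only: divide_inverse_commute[symmetric])
         (rule nonzero_mult_divide_mult_cancel_right, simp)
    show ?thesis
      unfolding * by (simp add: Im_divide power_inverse divide_inverse algebra_simps)
  qed
  ultimately show ?thesis by simp
qed

text \<open>An algebra of this kind has no division, so the inverse norm \<rho> is taken as a
  generator: its derivative is -(x dx + y dy) \<rho>^3, that of the angle is (x dy - y dx) \<rho>^2,
  and the norm is (x^2 + y^2) \<rho>.\<close>

lemma smooth_on_polar_inverse:
  "smooth_on (slit_plane \<theta>0) (\<lambda>p. (sqrt ((fst p)\<^sup>2 + (snd p)\<^sup>2) / c, polar_angle \<theta>0 p))"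
proof -
  let ?\<rho> = "\<lambda>p :: real \<times> real. inverse (sqrt ((fst p)\<^sup>2 + (snd p)\<^sup>2))"
  define B where "B = {fst, snd, ?\<rho>, polar_angle \<theta>0}"
  let ?A = "generated_algebra B"
  have gens: "fst \<in> ?A" "snd \<in> ?A" "?\<rho> \<in> ?A" "polar_angle \<theta>0 \<in> ?A"
    by (auto simp: B_def intro: generated_algebra.gen)
  have "derivatives_in ?A (slit_plane \<theta>0) fst"
    by (rule derivatives_inI[where h = "\<lambda>v p. fst v"])
       (auto intro!: derivative_eq_intros generated_algebra.const)
  moreover have "derivatives_in ?A (slit_plane \<theta>0) snd"
    by (rule derivatives_inI[where h = "\<lambda>v p. snd v"])
       (auto intro!: derivative_eq_intros generated_algebra.const)
  moreover have "derivatives_in ?A (slit_plane \<theta>0) ?\<rho>"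
  proof (rule derivatives_inI[where h = "\<lambda>v p. - 1 * ((fst p * fst v + snd p * snd v) * (?\<rho> p * (?\<rho> p * ?\<rho> p)))"])
    show "(?\<rho> has_derivative (\<lambda>v. - 1 * ((fst p * fst v + snd p * snd v) * (?\<rho> p * (?\<rho> p * ?\<rho> p))))) (at p)"
      if "p \<in> slit_plane \<theta>0" for p
    proof -
      let ?q = "\<lambda>p :: real \<times> real. (fst p)\<^sup>2 + (snd p)\<^sup>2"
      have "((\<lambda>t. inverse (sqrt t)) has_real_derivative
              - (?\<rho> p * (inverse (sqrt (?q p)) / 2) * ?\<rho> p)) (at (?q p))"
        by (rule DERIV_inverse'[OF DERIV_real_sqrt]) (use slit_plane_nonzero[OF that] in auto)
      then have "((\<lambda>t. inverse (sqrt t)) has_derivative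
              (\<lambda>h. - (?\<rho> p * (inverse (sqrt (?q p)) / 2) * ?\<rho> p) * h)) (at (?q p))"
        by (rule has_field_derivative_imp_has_derivative)
      moreover have "(?q has_derivative (\<lambda>v. 2 * (fst p * fst v + snd p * snd v))) (at p)"
        by (auto intro!: derivative_eq_intros)
      ultimately have "(?\<rho> has_derivative
          (\<lambda>v. - (?\<rho> p * (?\<rho> p / 2) * ?\<rho> p) * (2 * (fst p * fst v + snd p * snd v)))) (at p)"
        using has_derivative_compose by blast
      then show ?thesis
        by (rule has_derivative_eq_rhs) (simp add: fun_eq_iff)
    qed
    show "(\<lambda>p. - 1 * ((fst p * fst v + snd p * snd v) * (?\<rho> p * (?\<rho> p * ?\<rho> p)))) \<in> ?A" for v
      by (intro generated_algebra.mult generated_algebra.add generated_algebra.const gens)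
  qed
  moreover have "derivatives_in ?A (slit_plane \<theta>0) (polar_angle \<theta>0)"
  proof (rule derivatives_inI[OF polar_angle_has_derivative])
    have "(\<lambda>p. (fst p * snd v + (-1) * (snd p * fst v)) * (?\<rho> p * ?\<rho> p)) \<in> ?A" for v
      by (intro generated_algebra.mult generated_algebra.add generated_algebra.const gens)
    then show "(\<lambda>p. (fst p * snd v - snd p * fst v) * (?\<rho> p)\<^sup>2) \<in> ?A" for v
      by (simp add: power2_eq_square)
  qed
  \<comment> \<open>This also holds at a = 0, where the inverse has value 0, so the norm lies in the
    algebra as a function on the whole plane.\<close>
  moreover have "sqrt a = a * inverse (sqrt a)" if "0 \<le> a" for a
    using that by (metis divide_inverse real_div_sqrt)
  from this[OF sum_power2_ge_zero]
  have "(\<lambda>p. sqrt ((fst p)\<^sup>2 + (snd p)\<^sup>2) / c) =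
      (\<lambda>p. (fst p * fst p + snd p * snd p) * ?\<rho> p * (1 / c))"
    by (simp only: divide_inverse mult_1 power2_eq_square)
  then have "(\<lambda>p. sqrt ((fst p)\<^sup>2 + (snd p)\<^sup>2) / c) \<in> ?A"
    by (simp only:) (intro generated_algebra.mult generated_algebra.add generated_algebra.const gens)
  ultimately show ?thesis
    by (intro smooth_on_pair_generated_algebra[OF open_slit_plane, of B] gens) (auto simp: B_def)
qed

lemma open_polar_sector: "open {p :: real \<times> real. 0 < fst p \<and> \<bar>snd p - \<theta>0\<bar> < pi}"
proof -
  have "open ({0::real<..} \<times> {\<theta>0 - pi<..<\<theta>0 + pi})"
    by (intro open_Times open_greaterThan open_greaterThanLessThan)
  also have "\<dots> = {p. 0 < fst p \<and> \<bar>snd p - \<theta>0\<bar> < pi}"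
    by auto
  finally show ?thesis .
qed

lemma diffeomorphism_between_polar:
  assumes "c > 0"
  shows "diffeomorphism_between {p. 0 < fst p \<and> \<bar>snd p - \<theta>0\<bar> < pi} (slit_plane \<theta>0)
           (\<lambda>p. (c * fst p * cos (snd p), c * fst p * sin (snd p)))"
    (is "diffeomorphism_between ?W ?V ?\<phi>")
proof -
  let ?\<psi> = "\<lambda>p. (sqrt ((fst p)\<^sup>2 + (snd p)\<^sup>2) / c, polar_angle \<theta>0 p)"
  have smooth: "smooth_on ?W ?\<phi>" "smooth_on ?V ?\<psi>"
    by (rule smooth_on_polar_map[OF open_polar_sector], rule smooth_on_polar_inverse)
  have polar: "Complex (c * r * cos \<theta>) (c * r * sin \<theta>) * cis (- \<theta>0) =
      Complex (c * r * cos (\<theta> - \<theta>0)) (c * r * sin (\<theta> - \<theta>0))" for r \<theta>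
    by (simp add: complex_eq_iff cos_diff sin_diff algebra_simps)
  \<comment> \<open>The bound on a makes it the principal argument.\<close>
  have Ln: "Ln (Complex (c * r * cos a) (c * r * sin a)) = Complex (ln (c * r)) a"
    if "r > 0" "\<bar>a\<bar> < pi" for r a
    using that assms by (intro Ln_unique) (auto simp: exp_eq_polar complex_eq_iff)
  have "homeomorphism ?W ?V ?\<phi> ?\<psi>"
  proof (rule homeomorphismI)
    show "continuous_on ?W ?\<phi>" "continuous_on ?V ?\<psi>"
      using smooth by (auto simp: smooth_on_def dest!: spec[of _ 0])
    show "?\<phi> ` ?W \<subseteq> ?V"
    proof clarsimp
      fix r \<theta> :: real
      assume r: "0 < r" and a: "\<bar>\<theta> - \<theta>0\<bar> < pi"
      \<comment> \<open>Only points with vanishing sine could meet the slit; within the sector this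
        forces the angle difference 0, where the cosine is 1.\<close>
      have "0 < c * r * cos (\<theta> - \<theta>0)" if "sin (\<theta> - \<theta>0) = 0"
        using that a r assms by (simp add: sin_zero_pi_iff)
      then show "(c * r * cos \<theta>, c * r * sin \<theta>) \<in> slit_plane \<theta>0"
        unfolding slit_plane_def mem_Collect_eq fst_conv snd_conv polar
        using r assms by (auto simp: complex_nonpos_Reals_iff)
    qed
    show "?\<psi> ` ?V \<subseteq> ?W"
    proof clarify
      fix p assume p: "p \<in> ?V"
      define w where "w = Complex (fst p) (snd p) * cis (- \<theta>0)"
      have "w \<notin> \<real>\<^sub>\<le>\<^sub>0" "w \<noteq> 0"
        using p by (auto simp: slit_plane_def w_def)
      then have "\<bar>Im (Ln w)\<bar> < pi"
        using Im_Ln_less_pi[of w] mpi_less_Im_Ln[of w] by auto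
      then show "0 < fst (?\<psi> p) \<and> \<bar>snd (?\<psi> p) - \<theta>0\<bar> < pi"
        using slit_plane_nonzero[OF p] assms by (simp add: polar_angle_def flip: w_def)
    qed
    show "?\<psi> (?\<phi> p) = p" if "p \<in> ?W" for p
    proof -
      obtain r \<theta> where p: "p = (r, \<theta>)" by (cases p)
      have "(c * r * cos \<theta>)\<^sup>2 + (c * r * sin \<theta>)\<^sup>2 = (c * r)\<^sup>2"
        by (simp add: power_mult_distrib flip: distrib_left)
      then show ?thesis
        using that assms by (simp add: p polar_angle_def polar Ln)
    qed
    show "?\<phi> (?\<psi> p) = p" if p: "p \<in> ?V" for p
    proof -
      define z where "z = Complex (fst p) (snd p)"
      define w where "w = z * cis (- \<theta>0)"
      have "w \<noteq> 0"
        using p by (auto simp: slit_plane_def w_def z_def)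
      \<comment> \<open>Polar form of the rotated point, read off from exp (Ln w) = w; undoing the
        rotation gives that of z.\<close>
      then have "w = of_real (norm w) * cis (Im (Ln w))"
        by (metis exp_Ln exp_eq_polar norm_exp_eq_Re)
      moreover have "z = w * cis \<theta>0" "norm w = norm z"
        by (simp_all add: w_def mult.assoc cis_mult norm_mult)
      moreover have "cis (Im (Ln w)) * cis \<theta>0 = cis (polar_angle \<theta>0 p)"
        by (simp add: polar_angle_def cis_mult w_def z_def add.commute)
      ultimately have "z = of_real (norm z) * cis (polar_angle \<theta>0 p)"
        by (metis mult.assoc)
      then have "Complex (fst p) (snd p) =
          of_real (sqrt ((fst p)\<^sup>2 + (snd p)\<^sup>2)) * cis (polar_angle \<theta>0 p)"
        by (simp add: z_def complex_norm)
      then show ?thesis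
        using assms by (cases p) (simp add: complex_eq_iff)
    qed
  qed
  then show ?thesis
    unfolding diffeomorphism_between_def using smooth by blast
qed

section \<open>The identities together, and local congruence away from the origin\<close>

theorem mainTheorem2:
  fixes B0 \<kappa> :: real
  assumes "B0 > 0" and "\<kappa> = 1 / (4 * B0\<^sup>2)"
  shows
    "(\<forall>r \<theta>. r > 0 \<and> 0 < \<theta> \<and> \<theta> < pi / 2 \<longrightarrow>
        L20 B0 r \<theta> = U_mat *v F_kappa \<kappa> (2 * sqrt 2 * B0 * r * cos \<theta>) (2 * sqrt 2 * B0 * r * sin \<theta>)) \<and>
     conj_transpose U_mat ** U_mat = mat 1 \<and>
     holomorphic_isometry (\<lambda>z. U_mat *v z) \<and>
     (\<forall>r \<theta>. r > 0 \<longrightarrow>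
        L20_hat B0 r \<theta> = U_mat *v F_kappa \<kappa> (2 * sqrt 2 * B0 * r * cos \<theta>) (2 * sqrt 2 * B0 * r * sin \<theta>)) \<and>
     B0 = (4 * \<kappa>) powr (-1/2) \<and>
     (\<forall>q. q \<noteq> (0, 0) \<longrightarrow>
        (\<exists>p. fst p > 0 \<and> xy_coords B0 p = q) \<and>
        (\<forall>p. fst p > 0 \<and> xy_coords B0 p = q \<longrightarrow>
           locally_congruent_at
             {p. fst p > 0} (\<lambda>(r, \<theta>). L20_hat B0 r \<theta>) p
             (- {(0, 0)}) (\<lambda>(x, y). F_kappa \<kappa> x y) q))"
proof (intro conjI allI impI)
  show "L20 B0 r \<theta> = U_mat *v F_kappa \<kappa> (2 * sqrt 2 * B0 * r * cos \<theta>) (2 * sqrt 2 * B0 * r * sin \<theta>)"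
    if "r > 0 \<and> 0 < \<theta> \<and> \<theta> < pi / 2" for r \<theta>
    using that by (simp only: L20_eq_L20_hat L20_hat_eq[OF assms])
  show "L20_hat B0 r \<theta> = U_mat *v F_kappa \<kappa> (2 * sqrt 2 * B0 * r * cos \<theta>) (2 * sqrt 2 * B0 * r * sin \<theta>)"
    for r \<theta>
    by (rule L20_hat_eq[OF assms])
  show "conj_transpose U_mat ** U_mat = mat 1"
    by (simp add: conj_transpose_U_mat U_mat_mult_self)
  show "holomorphic_isometry (\<lambda>z. U_mat *v z)"
    by (rule holomorphic_isometry_U_mat)
  have "4 * \<kappa> = (inverse B0)\<^sup>2"
    using assms by (simp add: field_simps)
  then show "B0 = (4 * \<kappa>) powr (-1/2)"
    using assms(1) powr_minus[of "(inverse B0)\<^sup>2" "1/2"] by (simp add: powr_half_sqrt)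
next
  fix q :: "real \<times> real"
  assume q: "q \<noteq> (0, 0)"
  define c where "c = 2 * sqrt 2 * B0"
  have c: "c > 0"
    using assms(1) by (simp add: c_def)
  have xy: "xy_coords B0 = (\<lambda>p. (c * fst p * cos (snd p), c * fst p * sin (snd p)))"
    by (auto simp: xy_coords_def c_def)
  show "\<exists>p. fst p > 0 \<and> xy_coords B0 p = q"
  proof -
    \<comment> \<open>A preimage of q is its norm divided by the scale c, with its principal
      argument.\<close>
    define z where "z = Complex (fst q) (snd q)"
    have "z \<noteq> 0"
      using q by (auto simp: z_def complex_eq_iff prod_eq_iff)
    then have z: "z = of_real (norm z) * cis (Arg z)"
      using Arg_eq[of z] by (simp add: cis_conv_exp)
    have "c * (norm z / c) * cos (Arg z) = fst q" "c * (norm z / c) * sin (Arg z) = snd q"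
      using c arg_cong[OF z, of Re] arg_cong[OF z, of Im] by (simp_all add: z_def)
    then show ?thesis
      using c \<open>z \<noteq> 0\<close> by (intro exI[of _ "(norm z / c, Arg z)"]) (simp add: xy)
  qed
  fix p
  assume p: "fst p > 0 \<and> xy_coords B0 p = q"
  \<comment> \<open>Centring the sector at the angle of p itself handles every preimage of q,
    whatever its winding, and keeps q off the slit.\<close>
  let ?W = "{p' :: real \<times> real. 0 < fst p' \<and> \<bar>snd p' - snd p\<bar> < pi}"
  have diffeo: "diffeomorphism_between ?W (slit_plane (snd p)) (xy_coords B0)"
    unfolding xy by (rule diffeomorphism_between_polar[OF c])
  then have "xy_coords B0 ` ?W = slit_plane (snd p)"
    by (auto simp: diffeomorphism_between_def homeomorphism_def)
  then have "q \<in> slit_plane (snd p)"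
    using p by force
  moreover have "slit_plane (snd p) \<subseteq> - {(0, 0)}"
    using slit_plane_nonzero by force
  moreover have "L20_hat B0 (fst w) (snd w) =
      U_mat *v F_kappa \<kappa> (fst (xy_coords B0 w)) (snd (xy_coords B0 w))" for w
    unfolding L20_hat_eq[OF assms] by (simp add: xy c_def)
  ultimately have "open ?W \<and> p \<in> ?W \<and> ?W \<subseteq> {p. fst p > 0} \<and> open (slit_plane (snd p)) \<and>
      q \<in> slit_plane (snd p) \<and> slit_plane (snd p) \<subseteq> - {(0, 0)} \<and>
      diffeomorphism_between ?W (slit_plane (snd p)) (xy_coords B0) \<and> xy_coords B0 p = q \<and>
      holomorphic_isometry ((*v) U_mat) \<and>
      (\<forall>w\<in>?W. (case w of (r, \<theta>) \<Rightarrow> L20_hat B0 r \<theta>) =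
         U_mat *v (case xy_coords B0 w of (x, y) \<Rightarrow> F_kappa \<kappa> x y))"
    using p diffeo holomorphic_isometry_U_mat open_polar_sector[of "snd p"]
    by (simp add: case_prod_beta Collect_mono open_slit_plane)
  then show "locally_congruent_at {p. fst p > 0} (\<lambda>(r, \<theta>). L20_hat B0 r \<theta>) p
      (- {(0, 0)}) (\<lambda>(x, y). F_kappa \<kappa> x y) q"
    unfolding locally_congruent_at_def
    by blast
qed

end
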